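(* Let $(\mathbb{X},\oplus,\otimes,\mathbb{0},\mathbb{1})$ be a linearly ordered radicable idempotent semifield, let $n\geq 1$, let $\mathbf{p}\in\mathbb{X}^{n}$ be a nonzero vector and $\mathbf{q}\in\mathbb{X}^{n}$ a regular vector. Consider the problem of minimizing $\mathbf{q}^{-}\mathbf{x}\mathbf{x}^{-}\mathbf{p}$ over all regular vectors $\mathbf{x}\in\mathbb{X}^{n}$. Then the minimum value in this problem is equal to $$\Delta=\mathbf{q}^{-}\mathbf{p},$$ and all regular solutions of the problem are given by $$\mathbf{x}=(\mathbf{I}\oplus\Delta^{-1}\mathbf{p}\mathbf{q}^{-})\mathbf{u},\qquad \mathbf{u}>\mathbf{0};$$ that is, a regular vector $\mathbf{x}$ attains the minimum if and only if it has this form for some $\mathbf{u}\in\mathbb{X}^{n}$ with all components $>\mathbb{0}$.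
   Context: Idempotent semifield: $\mathbb{X}$ is a set with two associative and commutative operations $\oplus$ (addition) and $\otimes$ (multiplication, sign usually omitted) with neutral elements $\mathbb{0}$ and $\mathbb{1}$ respectively; addition is idempotent ($x\oplus x=x$), multiplication distributes over addition, and each $x\neq\mathbb{0}$ has a multiplicative inverse $x^{-1}$ (and $\mathbb{0}$ is absorbing for multiplication). The order is defined by $x\leq y$ iff $x\oplus y=y$ and is assumed linear, so $x\oplus y=\max(x,y)$; "minimize" refers to this order. Radicable means that $x^{m}=a$ has a solution for every $a\neq\mathbb{0}$ and every integer $m\geq1$. Vectors and matrices: vectors in $\mathbb{X}^{n}$ are column vectors; matrix/vector operations follow the usual rules with $\oplus,\otimes$ in place of ordinary addition and multiplication; inequalities are componentwise. $\mathbf{0}$ is the vector with all entries $\mathbb{0}$. $\mathbf{I}$ is the identity matrix ($\mathbb{1}$ on the diagonal, $\mathbb{0}$ elsewhere). A vector is nonzero if it has at least one entry $\neq\mathbb{0}$, and regular if none of its entries is $\mathbb{0}$. For a nonzero column vector $\mathbf{x}=(x_{i})$, the multiplicative conjugate transpose is the row vector $\mathbf{x}^{-}=(x_{i}^{-})$ with $x_{i}^{-}=x_{i}^{-1}$ if $x_{i}\neq\mathbb{0}$ and $x_{i}^{-}=\mathbb{0}$ otherwise. *)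

theory Defs
  imports "HOL-Analysis.Finite_Cartesian_Product"
begin

text \<open>
  The generic symbols \<open>+\<close>, \<open>*\<close>, \<open>0\<close>, \<open>1\<close> stand for the semifield operations and neutral
  elements, so sums are maxima. The value of \<open>inverse 0\<close> is left unspecified.
  The class \<^class>\<open>comm_semiring_1\<close> includes \<open>0 \<noteq> 1\<close>; this excludes only the one-element
  structure, over which there are no nonzero vectors. The operation \<open>/\<close> is present only
  because it is part of the library class \<^class>\<open>inverse\<close>.
\<close>

class idempotent_semifield = comm_semiring_1 + inverse +
  assumes add_idempotent: "x + x = x"
    and mult_inverse: "x \<noteq> 0 \<Longrightarrow> x * inverse x = 1"
    and divide_eq_mult_inverse: "x / y = x * inverse y"

class linordered_idempotent_semifield = idempotent_semifield + linorder +
  assumes le_iff_add_eq: "x \<le> y \<longleftrightarrow> x + y = y"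

class radicable_linordered_idempotent_semifield = linordered_idempotent_semifield +
  assumes radicable: "a \<noteq> 0 \<Longrightarrow> 1 \<le> m \<Longrightarrow> \<exists>x. x ^ m = a"

definition nonzero_vec :: "'a::zero ^ 'n \<Rightarrow> bool" where
  "nonzero_vec x \<longleftrightarrow> (\<exists>i. x $ i \<noteq> 0)"

definition regular_vec :: "'a::zero ^ 'n \<Rightarrow> bool" where
  "regular_vec x \<longleftrightarrow> (\<forall>i. x $ i \<noteq> 0)"

text \<open>
  Row vectors are represented by their entries, in the same type as column vectors. Hence a
  row times a column is \<^const>\<open>scalar_product\<close> (which involves no conjugation), and a column
  times a row is \<open>column_row_product\<close>.
\<close>

definition conj_transpose :: "'a::{zero,inverse} ^ 'n \<Rightarrow> 'a ^ 'n" where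
  "conj_transpose x = (\<chi> i. if x $ i \<noteq> 0 then inverse (x $ i) else 0)"

definition column_row_product :: "'a::times ^ 'm \<Rightarrow> 'a ^ 'n \<Rightarrow> 'a ^ 'n ^ 'm" where
  "column_row_product v w = (\<chi> i j. v $ i * w $ j)"

end

theory Submission
  imports Defs
begin

text \<open>
  Write \<open>s = q\<^sup>-x\<close> and \<open>A = \<Delta>\<^sup>-\<^sup>1pq\<^sup>-\<close>. Since sums are maxima, the objective \<open>s (x\<^sup>-p)\<close> is the maximum of
  the products \<open>s x\<^sub>j\<^sup>-\<^sup>1p\<^sub>j\<close>. Keeping from \<open>s\<close> only its term with index \<open>j\<close> cancels \<open>x\<^sub>j\<close> and leaves the
  terms \<open>q\<^sub>j\<^sup>-\<^sup>1p\<^sub>j\<close> of \<open>\<Delta>\<close>, so \<open>\<Delta>\<close> is a lower bound (\<open>delta_le_objective\<close>).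

  A regular \<open>x\<close> attains this bound exactly if \<open>p\<^sub>js \<le> \<Delta>x\<^sub>j\<close> for every \<open>j\<close> (\<open>objective_le_iff\<close>). After
  division by \<open>\<Delta>\<close> this is \<open>Ax \<le> x\<close>, in other words \<open>(I \<oplus> A)x = x\<close>. Every optimal \<open>x\<close> therefore has
  the claimed form, with \<open>u = x\<close>. Conversely, the scalar \<open>q\<^sup>-(I \<oplus> A)u\<close> equals \<open>q\<^sup>-u\<close>, because
  \<open>q\<^sup>-\<Delta>\<^sup>-\<^sup>1p\<close> is the unit. So \<open>x = (I \<oplus> A)u\<close> has the same \<open>s\<close> as \<open>u\<close>, and the inequalities
  \<open>p\<^sub>js \<le> \<Delta>x\<^sub>j\<close> can be read off from its entries \<open>u\<^sub>j \<oplus> \<Delta>\<^sup>-\<^sup>1p\<^sub>js\<close>. Taking every entry of \<open>u\<close> equal to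
  the unit shows that the bound is attained.
\<close>

lemma add_le_iff:
  fixes a b c :: "'a::linordered_idempotent_semifield"
  shows "a + b \<le> c \<longleftrightarrow> a \<le> c \<and> b \<le> c"
proof
  have "a \<le> a + b" "b \<le> a + b"
    by (metis le_iff_add_eq add.assoc add.commute add_idempotent)+
  then show "a + b \<le> c \<Longrightarrow> a \<le> c \<and> b \<le> c"
    by force
  show "a \<le> c \<and> b \<le> c \<Longrightarrow> a + b \<le> c"
    by (simp add: le_iff_add_eq add.assoc)
qed

lemma zero_least:
  fixes a :: "'a::linordered_idempotent_semifield"
  shows "0 \<le> a"
  by (simp add: le_iff_add_eq)

lemma zero_less_iff:
  fixes a :: "'a::linordered_idempotent_semifield"
  shows "0 < a \<longleftrightarrow> a \<noteq> 0"
  using zero_least[of a] by (auto simp: less_le)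

lemma sum_le_iff:
  fixes f :: "'b \<Rightarrow> 'a::linordered_idempotent_semifield"
  assumes "finite S"
  shows "sum f S \<le> c \<longleftrightarrow> (\<forall>i\<in>S. f i \<le> c)"
  using assms by (induction S rule: finite_induct) (simp_all add: zero_least add_le_iff)

lemma mult_left_mono_semifield:
  fixes a b c :: "'a::linordered_idempotent_semifield"
  assumes "a \<le> b"
  shows "c * a \<le> c * b"
  using assms by (metis le_iff_add_eq distrib_left)

lemma inverse_mult_le_iff:
  fixes a b x :: "'a::linordered_idempotent_semifield"
  assumes "x \<noteq> 0"
  shows "inverse x * a \<le> b \<longleftrightarrow> a \<le> x * b"
proof -
  have cancel: "x * (inverse x * c) = c" "inverse x * (x * c) = c" for c
    using mult_inverse[OF assms] by (metis mult.assoc mult.commute mult_1_left)+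
  show ?thesis
    using mult_left_mono_semifield[of "inverse x * a" b x]
      mult_left_mono_semifield[of a "x * b" "inverse x"] by (auto simp: cancel)
qed

lemma conj_transpose_regular_nth:
  assumes "regular_vec x"
  shows "conj_transpose x $ i = inverse (x $ i)"
  using assms by (simp add: conj_transpose_def regular_vec_def)

lemma term_le_scalar_product:
  fixes v w :: "'a::linordered_idempotent_semifield ^ 'n"
  shows "v $ j * w $ j \<le> scalar_product v w"
  using sum_le_iff[of UNIV "\<lambda>i. v $ i * w $ i" "scalar_product v w"]
  by (simp add: scalar_product_def)

text \<open>This is what makes \<open>\<Delta>\<close> invertible, so that the solution formula makes sense.\<close>

lemma scalar_product_conj_nonzero:
  fixes p q :: "'a::linordered_idempotent_semifield ^ 'n"
  assumes "nonzero_vec p" and "regular_vec q"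
  shows "scalar_product (conj_transpose q) p \<noteq> 0"
proof
  assume "scalar_product (conj_transpose q) p = 0"
  then have le: "inverse (q $ i) * p $ i \<le> 0" for i
    using term_le_scalar_product[of "conj_transpose q" i p]
    by (simp add: conj_transpose_regular_nth[OF assms(2)])
  have "p $ i \<le> 0" for i
    using le[of i] inverse_mult_le_iff[of "q $ i" "p $ i" 0] assms(2)
    by (simp add: regular_vec_def)
  then show False
    using assms(1) by (auto simp: nonzero_vec_def zero_least intro: antisym)
qed

text \<open>
  This turns a bound on the objective function (take \<open>s = q\<^sup>-x\<close>) into one division-free inequality
  per coordinate, using that multiplication by \<open>x\<^sub>j\<close> is an order automorphism.
\<close>

lemma objective_le_iff:
  fixes p x :: "'a::linordered_idempotent_semifield ^ 'n"
  assumes "regular_vec x"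
  shows "s * scalar_product (conj_transpose x) p \<le> c \<longleftrightarrow> (\<forall>j. p $ j * s \<le> c * x $ j)"
proof -
  have "s * (inverse (x $ j) * p $ j) \<le> c \<longleftrightarrow> p $ j * s \<le> c * x $ j" for j
    using inverse_mult_le_iff[of "x $ j" "p $ j * s" c] assms
    by (simp add: regular_vec_def ac_simps)
  then show ?thesis
    by (simp add: scalar_product_def conj_transpose_regular_nth[OF assms] sum_distrib_left
        sum_le_iff)
qed

text \<open>
  Each term of the left side is a product of a term of \<open>q\<^sup>-x\<close> and a term of \<open>x\<^sup>-p\<close>, as
  \<open>q\<^sub>j\<^sup>-\<^sup>1p\<^sub>j = (q\<^sub>j\<^sup>-\<^sup>1x\<^sub>j)(x\<^sub>j\<^sup>-\<^sup>1p\<^sub>j)\<close>.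
\<close>

lemma delta_le_objective:
  fixes p q x :: "'a::linordered_idempotent_semifield ^ 'n"
  assumes "regular_vec q" and "regular_vec x"
  shows "scalar_product (conj_transpose q) p
    \<le> scalar_product (conj_transpose q) x * scalar_product (conj_transpose x) p" (is "_ \<le> ?s * ?t")
proof -
  have "inverse (q $ j) * p $ j \<le> ?s * ?t" for j
  proof -
    have "x $ j * inverse (x $ j) = 1"
      using assms(2) by (simp add: regular_vec_def mult_inverse)
    then have "inverse (q $ j) * p $ j
        = (inverse (x $ j) * p $ j) * (inverse (q $ j) * x $ j)"
      by (metis mult.assoc mult.commute mult_1_left)
    also have "\<dots> \<le> (inverse (x $ j) * p $ j) * ?s"
      using term_le_scalar_product[of "conj_transpose q" j x]
      by (simp add: conj_transpose_regular_nth[OF assms(1)] mult_left_mono_semifield)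
    also have "\<dots> = ?s * (inverse (x $ j) * p $ j)"
      by (rule mult.commute)
    also have "\<dots> \<le> ?s * ?t"
      using term_le_scalar_product[of "conj_transpose x" j p]
      by (simp add: conj_transpose_regular_nth[OF assms(2)] mult_left_mono_semifield)
    finally show ?thesis .
  qed
  then show ?thesis
    by (simp add: scalar_product_def[of _ p] conj_transpose_regular_nth[OF assms(1)] sum_le_iff)
qed

lemma identity_plus_rank_one_mult_nth:
  fixes v w u :: "'a::comm_semiring_1 ^ 'n"
  shows "((mat 1 + column_row_product v w) *v u) $ j = u $ j + v $ j * scalar_product w u"
proof -
  have "(mat 1 $ j $ i + v $ j * w $ i) * u $ i
      = (if j = i then u $ i else 0) + v $ j * (w $ i * u $ i)" for i
    by (simp add: mat_def distrib_right mult.assoc)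
  then show ?thesis
    by (simp add: matrix_vector_mult_def column_row_product_def scalar_product_def
        sum.distrib sum_distrib_left)
qed

text \<open>
  The identity part and the rank-one part each contribute \<open>wu\<close>, the latter as \<open>(wv)(wu)\<close>, and
  idempotency of addition merges the two copies. In the characterization of the minimizers, this is
  what makes the implicit inequalities \<open>p\<^sub>j(q\<^sup>-x) \<le> \<Delta>x\<^sub>j\<close> checkable on the parameter \<open>u\<close>.
\<close>

lemma scalar_product_identity_plus_rank_one:
  fixes v w u :: "'a::idempotent_semifield ^ 'n"
  assumes "scalar_product w v = 1"
  shows "scalar_product w ((mat 1 + column_row_product v w) *v u) = scalar_product w u"
proof -
  have "scalar_product w ((mat 1 + column_row_product v w) *v u)
      = (\<Sum>j\<in>UNIV. w $ j * (u $ j + v $ j * scalar_product w u))"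
    by (simp add: scalar_product_def[of w "_ *v _"] identity_plus_rank_one_mult_nth)
  also have "\<dots> = scalar_product w u + scalar_product w v * scalar_product w u"
    by (simp add: scalar_product_def[of w u] scalar_product_def[of w v] distrib_left
        sum.distrib sum_distrib_right mult.assoc)
  finally show ?thesis
    using assms by (simp add: add_idempotent)
qed

text \<open>
  Since \<open>\<Delta>\<close> is a lower bound (\<open>delta_le_objective\<close>), the inequality on the left says that \<open>x\<close>
  attains the minimum; as an inequality it splits into one condition \<open>\<Delta>\<^sup>-\<^sup>1p\<^sub>j(q\<^sup>-x) \<le> x\<^sub>j\<close> per
  coordinate, and such a condition says exactly that adding the left side to \<open>x\<^sub>j\<close> does not change \<open>x\<^sub>j\<close>.
\<close>

lemma objective_attains_delta_iff:
  fixes p q x :: "'a::linordered_idempotent_semifield ^ 'n"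
  assumes "nonzero_vec p" and "regular_vec q"
  defines "\<Delta> \<equiv> scalar_product (conj_transpose q) p"
  shows "regular_vec x \<and>
      scalar_product (conj_transpose q) x * scalar_product (conj_transpose x) p \<le> \<Delta> \<longleftrightarrow>
    (\<exists>u. (\<forall>i. 0 < u $ i) \<and>
      x = (mat 1 + column_row_product (inverse \<Delta> *s p) (conj_transpose q)) *v u)"
    (is "?opt \<longleftrightarrow> (\<exists>u. _ \<and> x = ?M *v u)")
proof -
  let ?s = "scalar_product (conj_transpose q)"
  have \<Delta>: "\<Delta> \<noteq> 0"
    unfolding \<Delta>_def using assms(1,2) by (rule scalar_product_conj_nonzero)
  have M_nth: "(?M *v u) $ j = u $ j + inverse \<Delta> * (p $ j * ?s u)" for u j
    by (simp add: identity_plus_rank_one_mult_nth mult.assoc)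
  have "?s (c *s p) = c * \<Delta>" for c
    by (simp add: scalar_product_def \<Delta>_def sum_distrib_left ac_simps)
  then have unit: "?s (inverse \<Delta> *s p) = 1"
    using mult_inverse[OF \<Delta>] by (simp add: mult.commute)
  show ?thesis
  proof
    assume opt: ?opt
    then have "inverse \<Delta> * (p $ j * ?s x) \<le> x $ j" for j
      using objective_le_iff[of x "?s x" p \<Delta>] by (simp add: inverse_mult_le_iff[OF \<Delta>])
    then have "x = ?M *v x"
      by (simp add: vec_eq_iff M_nth le_iff_add_eq add.commute)
    moreover have "\<forall>i. 0 < x $ i"
      using opt by (simp add: regular_vec_def zero_less_iff)
    ultimately show "\<exists>u. (\<forall>i. 0 < u $ i) \<and> x = ?M *v u"
      by blast
  next
    assume "\<exists>u. (\<forall>i. 0 < u $ i) \<and> x = ?M *v u"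
    then obtain u where u: "\<And>i. 0 < u $ i" and x: "x = ?M *v u"
      by blast
    have "u $ j \<le> x $ j \<and> inverse \<Delta> * (p $ j * ?s u) \<le> x $ j" for j
      using add_le_iff[of "u $ j" "inverse \<Delta> * (p $ j * ?s u)" "x $ j"] by (simp add: x M_nth)
    then have ge: "u $ j \<le> x $ j" "p $ j * ?s u \<le> \<Delta> * x $ j" for j
      by (simp_all add: inverse_mult_le_iff[OF \<Delta>])
    have "0 < x $ j" for j
      using u[of j] ge(1)[of j] by simp
    then have regular: "regular_vec x"
      by (simp add: regular_vec_def zero_less_iff)
    have "?s x = ?s u"
      unfolding x using unit by (rule scalar_product_identity_plus_rank_one)
    then show ?opt
      using regular ge(2) by (simp add: objective_le_iff)
  qed
qed

theorem theorem7:
  fixes p q :: "'a::radicable_linordered_idempotent_semifield ^ 'n"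
  assumes "nonzero_vec p"
    and "regular_vec q"
  shows "let f = (\<lambda>x :: 'a ^ 'n. scalar_product (conj_transpose q) x * scalar_product (conj_transpose x) p);
             \<Delta> = scalar_product (conj_transpose q) p
         in (\<exists>x. regular_vec x \<and> f x = \<Delta>) \<and>
            (\<forall>x. regular_vec x \<longrightarrow> \<Delta> \<le> f x) \<and>
            (\<forall>x. is_arg_min f regular_vec x \<longleftrightarrow>
                 (\<exists>u. (\<forall>i. 0 < u $ i) \<and>
                      x = (mat 1 + column_row_product (inverse \<Delta> *s p) (conj_transpose q)) *v u))"
proof -
  define f where "f = (\<lambda>x :: 'a ^ 'n. scalar_product (conj_transpose q) x * scalar_product (conj_transpose x) p)"
  define \<Delta> where "\<Delta> = scalar_product (conj_transpose q) p"
  define M where "M = mat 1 + column_row_product (inverse \<Delta> *s p) (conj_transpose q)"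
  have lower: "\<Delta> \<le> f x" if "regular_vec x" for x
    unfolding \<Delta>_def f_def using assms(2) that by (rule delta_le_objective)
  have opt: "regular_vec x \<and> f x \<le> \<Delta> \<longleftrightarrow> (\<exists>u. (\<forall>i. 0 < u $ i) \<and> x = M *v u)" for x
    unfolding f_def \<Delta>_def M_def by (rule objective_attains_delta_iff[OF assms])
  have "regular_vec (M *v 1) \<and> f (M *v 1) \<le> \<Delta>"
    unfolding opt by (rule exI[of _ 1]) (simp add: zero_less_iff)
  then have attained: "\<exists>x. regular_vec x \<and> f x = \<Delta>"
    using lower by (meson antisym)
  have "is_arg_min f regular_vec x \<longleftrightarrow> regular_vec x \<and> f x \<le> \<Delta>" for x
    unfolding is_arg_min_def using attained lower by (metis leD not_less order_trans)
  then have "is_arg_min f regular_vec x \<longleftrightarrow> (\<exists>u. (\<forall>i. 0 < u $ i) \<and> x = M *v u)" for x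
    by (simp only: opt)
  then show ?thesis
    using attained lower unfolding f_def \<Delta>_def M_def Let_def by blast
qed

end
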